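(* Let $k\in\mathbb{N}\cup\{\infty,\omega\}$ with $k\ge 1$, let $I\subset\mathbb{R}$ be an open interval, and let $\phi:I\to\mathbb{R}$ be a $\mathcal{C}^k$ function whose derivative does not vanish on $I$. Put $\Delta=\phi(I)$, let $\phi^{-1}:\Delta\to I$ be the inverse of $\phi:I\to\Delta$, and assume that the addition domain $\mathcal{D}_I=\{(\xi,\eta)\in\Delta\times\Delta : \phi^{-1}(\xi)+\phi^{-1}(\eta)\in I\}$ is non-empty. Then the function $$R:\mathcal{D}_I\to\mathbb{R},\qquad R(x,y)=\phi\big(\phi^{-1}(x)+\phi^{-1}(y)\big)$$ is an explicit addition formula for $\phi$, that is, $\phi(t+\tau)=R(\phi(t),\phi(\tau))$ for all $t,\tau\in I$ with $t+\tau\in I$.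
   Context: $\mathcal{C}^\omega$ denotes the class of real analytic functions. Since $\phi$ has non-vanishing derivative on the interval $I$, it is a $\mathcal{C}^k$ diffeomorphism from $I$ onto the open interval $\Delta=\phi(I)$. A bivariate function $R(x,y)$ is called an explicit addition formula (or explicit addition theorem) for $\phi$ when $\phi(t+\tau)=R(\phi(t),\phi(\tau))$ wherever the involved functions are defined. *)

theory Defs
  imports "HOL-Analysis.Analysis" "HOL-Library.Extended_Nat"
begin

text \<open>Differentiability classes: \<open>Order n\<close> is \<open>C\<close> to the \<open>n\<close> for a natural number \<open>n\<close>,
  \<open>Order \<infinity>\<close> is the smooth class, and \<open>Analytic\<close> is the real analytic class.\<close>

datatype smoothness = Order enat | Analytic

definition real_analytic_on :: "(real \<Rightarrow> real) \<Rightarrow> real set \<Rightarrow> bool" where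
  "real_analytic_on f S \<longleftrightarrow>
     (\<forall>x\<in>S. \<exists>r>0. \<exists>a::nat \<Rightarrow> real. \<forall>y\<in>ball x r \<inter> S. (\<lambda>n. a n * (y - x) ^ n) sums f y)"

text \<open>Intended for open \<open>S\<close>: there the values of the iterated derivatives on \<open>S\<close> depend only on
  the values of \<open>f\<close> on \<open>S\<close>.\<close>

fun C_class_on :: "smoothness \<Rightarrow> (real \<Rightarrow> real) \<Rightarrow> real set \<Rightarrow> bool" where
  "C_class_on (Order k) f S \<longleftrightarrow>
     (\<forall>n. enat n < k \<longrightarrow> (\<forall>x\<in>S. (deriv ^^ n) f differentiable (at x))) \<and>
     (\<forall>n. enat n \<le> k \<longrightarrow> continuous_on S ((deriv ^^ n) f))"
| "C_class_on Analytic f S \<longleftrightarrow> real_analytic_on f S"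

definition addition_domain :: "(real \<Rightarrow> real) \<Rightarrow> real set \<Rightarrow> (real \<times> real) set" where
  "addition_domain \<phi> I =
     {(\<xi>, \<eta>). \<xi> \<in> \<phi> ` I \<and> \<eta> \<in> \<phi> ` I \<and> the_inv_into I \<phi> \<xi> + the_inv_into I \<phi> \<eta> \<in> I}"

text \<open>\<open>D\<close> is the domain of the bivariate function \<open>R\<close>. Whenever \<open>\<phi>\<close> is defined at \<open>t\<close>, \<open>\<tau>\<close> and
  \<open>t + \<tau>\<close>, the right-hand side must be defined too.\<close>

definition explicit_addition_formula ::
    "(real \<times> real) set \<Rightarrow> (real \<Rightarrow> real \<Rightarrow> real) \<Rightarrow> real set \<Rightarrow> (real \<Rightarrow> real) \<Rightarrow> bool" where
  "explicit_addition_formula D R I \<phi> \<longleftrightarrow>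
     (\<forall>t\<in>I. \<forall>\<tau>\<in>I. t + \<tau> \<in> I \<longrightarrow> (\<phi> t, \<phi> \<tau>) \<in> D \<and> \<phi> (t + \<tau>) = R (\<phi> t) (\<phi> \<tau>))"

end

theory Submission
  imports Defs
begin

text \<open>The formula \<open>\<phi> (t + \<tau>) = \<phi> (\<phi>\<inverse> (\<phi> t) + \<phi>\<inverse> (\<phi> \<tau>))\<close> is mere cancellation once \<open>\<phi>\<close> is
  known to be injective on \<open>I\<close>; the same cancellation puts \<open>(\<phi> t, \<phi> \<tau>)\<close> into the addition
  domain. Injectivity is Rolle's theorem: two points of the interval \<open>I\<close> with a common value would
  enclose a zero of the derivative. Every class \<open>C\<close> to the \<open>k\<close> with \<open>k \<ge> 1\<close>, the real analytic one
  included, supplies the differentiability that this argument needs.\<close>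

text \<open>Power series can be differentiated inside their interval of convergence; the derivative is
  taken only at the centre of each expansion, and openness provides a whole ball around the centre
  on which the function agrees with its series.\<close>

lemma real_analytic_on_imp_differentiable:
  assumes "real_analytic_on f S" "open S" "x \<in> S"
  shows "f differentiable (at x)"
proof -
  obtain r a where r: "r > 0" and
    series: "\<And>y. y \<in> ball x r \<inter> S \<Longrightarrow> (\<lambda>n. a n * (y - x) ^ n) sums f y"
    using assms(1,3) unfolding real_analytic_on_def by blast
  obtain e where e: "e > 0" "ball x e \<subseteq> S"
    using assms(2,3) by (meson open_contains_ball)
  define d where "d = min r e"
  have d: "d > 0"
    using r e by (simp add: d_def)
  have sums: "(\<lambda>n. a n * z ^ n) sums f (z + x)" if "norm z < d" for z
  proof -
    have "z + x \<in> ball x r \<inter> S"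
      using that e(2) by (auto simp: d_def dist_real_def)
    from series[OF this] show ?thesis by simp
  qed
  have "((\<lambda>z. \<Sum>n. a n * z ^ n) has_field_derivative (\<Sum>n. diffs a n * 0 ^ n)) (at 0)"
    by (rule termdiffs_strong'[where K = d]) (use sums d in \<open>auto intro: sums_summable\<close>)
  then have "((\<lambda>z. f (z + x)) has_field_derivative (\<Sum>n. diffs a n * 0 ^ n)) (at 0)"
    by (rule has_field_derivative_transform_within_open[where S = "ball 0 d"])
      (use sums d in \<open>auto intro!: sums_unique[symmetric]\<close>)
  then have "(f has_field_derivative (\<Sum>n. diffs a n * 0 ^ n)) (at x)"
    using DERIV_shift[of f _ 0 x] by simp
  then show ?thesis
    using real_differentiable_def by blast
qed

lemma C_class_on_imp_differentiable:
  assumes "C_class_on k f S" "k \<noteq> Order 0" "open S" "x \<in> S"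
  shows "f differentiable (at x)"
proof (cases k)
  case (Order m)
  then have "enat 0 < m"
    using assms(2) by (simp add: zero_enat_def[symmetric])
  then have "(deriv ^^ 0) f differentiable (at x)"
    using assms(1,4) unfolding Order C_class_on.simps by blast
  then show ?thesis by simp
next
  case Analytic
  then show ?thesis
    using assms real_analytic_on_imp_differentiable by simp
qed

lemma inj_on_interval_if_deriv_nonzero:
  fixes f :: "real \<Rightarrow> real"
  assumes "is_interval I"
    and diff: "\<And>x. x \<in> I \<Longrightarrow> f differentiable (at x)"
    and nz: "\<And>x. x \<in> I \<Longrightarrow> deriv f x \<noteq> 0"
  shows "inj_on f I"
proof (rule linorder_inj_onI)
  fix a b assume "a < b" and ab: "a \<in> I" "b \<in> I"
  have sub: "x \<in> I" if "a \<le> x" "x \<le> b" for x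
    using assms(1) ab that unfolding is_interval_1 by blast
  show "f a \<noteq> f b"
  proof
    assume "f a = f b"
    have "continuous_on {a..b} f"
      by (intro continuous_at_imp_continuous_on ballI differentiable_imp_continuous_within diff sub)
        auto
    then obtain z where z: "a < z" "z < b" "DERIV f z :> 0"
      using Rolle[OF \<open>a < b\<close> \<open>f a = f b\<close>] diff sub by (metis less_imp_le)
    then show False
      using nz[OF sub[of z]] DERIV_imp_deriv by fastforce
  qed
qed auto

theorem theorem2p1:
  fixes k :: smoothness and I :: "real set" and \<phi> :: "real \<Rightarrow> real"
    and R :: "real \<Rightarrow> real \<Rightarrow> real"
  assumes "k \<noteq> Order 0"
    and "open I" and "is_interval I"
    and "C_class_on k \<phi> I"
    and "\<forall>t\<in>I. deriv \<phi> t \<noteq> 0"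
    and "addition_domain \<phi> I \<noteq> {}"
    and "\<forall>(x, y) \<in> addition_domain \<phi> I. R x y = \<phi> (the_inv_into I \<phi> x + the_inv_into I \<phi> y)"
  shows "explicit_addition_formula (addition_domain \<phi> I) R I \<phi>"
proof -
  have "inj_on \<phi> I"
    using assms(2-5) C_class_on_imp_differentiable[OF assms(4,1,2)]
    by (intro inj_on_interval_if_deriv_nonzero) auto
  then have inv: "the_inv_into I \<phi> (\<phi> t) = t" if "t \<in> I" for t
    using that by (rule the_inv_into_f_f)
  show ?thesis
    unfolding explicit_addition_formula_def
  proof (intro ballI impI)
    fix t \<tau> assume t: "t \<in> I" "\<tau> \<in> I" "t + \<tau> \<in> I"
    then have dom: "(\<phi> t, \<phi> \<tau>) \<in> addition_domain \<phi> I"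
      by (simp add: addition_domain_def inv)
    then have "R (\<phi> t) (\<phi> \<tau>) = \<phi> (the_inv_into I \<phi> (\<phi> t) + the_inv_into I \<phi> (\<phi> \<tau>))"
      using assms(7) by blast
    then show "(\<phi> t, \<phi> \<tau>) \<in> addition_domain \<phi> I \<and> \<phi> (t + \<tau>) = R (\<phi> t) (\<phi> \<tau>)"
      using dom t by (simp add: inv)
  qed
qed

end
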